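(* The numbers $B_{n,k}$ of Dyck paths of order $n$ which hit or cross the line $y=x+k$ are determined by the following recurrence formula: for all integers $n\ge 1$ and $k\ge 1$, $$B_{n,k}=\sum_{i=1}^{n}\left(B_{i-1,k-1}\,C_{n-i}+C_{i-1}\,B_{n-i,k}-B_{i-1,k-1}\,B_{n-i,k}\right).$$
   Context: A Dyck path of order $n\ge 0$ is a lattice path in the plane from $(0,0)$ to $(n,n)$ consisting of $2n$ unit steps, each going either up (adding $(0,1)$) or to the right (adding $(1,0)$), that never goes below the diagonal $y=x$ (touching the diagonal is allowed). The number of Dyck paths of order $n$ is the Catalan number $C_n=\frac{1}{n+1}\binom{2n}{n}$ (so $C_0=1$). For integers $n,k\ge 0$, $B_{n,k}$ denotes the number of Dyck paths of order $n$ which hit or cross the line $y=x+k$, i.e. which visit at least one lattice point $(x,y)$ with $y-x\ge k$. In particular $B_{n,0}=C_n$ for $n\ge 0$, and $B_{n,k}=0$ whenever $k>n$ (so $B_{0,k}=0$ for $k\ge 1$). Equivalently, for $n,k\ge 1$, $B_{n,k}$ is the number of sequences $a_1,\dots,a_{2n}$ of nonnegative integers with $a_1=1$, $a_{2n}=0$, $|a_i-a_{i+1}|=1$ for $1\le i<2n$, in which the value $k$ occurs at least once. *)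

theory Defs
  imports Complex_Main "HOL-Library.Product_Plus"
begin

datatype step = Up | Rgt

fun step_vec :: "step \<Rightarrow> int \<times> int" where
  "step_vec Up = (0, 1)"
| "step_vec Rgt = (1, 0)"

text \<open>A lattice path starting at the origin is represented by its list of steps.\<close>

definition point_after :: "step list \<Rightarrow> nat \<Rightarrow> int \<times> int" where
  "point_after p j = (\<Sum>s\<leftarrow>take j p. step_vec s)"

definition visited :: "step list \<Rightarrow> (int \<times> int) set" where
  "visited p = point_after p ` {0..length p}"

definition dyck_paths :: "nat \<Rightarrow> step list set" where
  "dyck_paths n = {p. length p = 2 * n \<and> point_after p (length p) = (int n, int n)
                      \<and> (\<forall>(x, y) \<in> visited p. x \<le> y)}"

definition B :: "nat \<Rightarrow> nat \<Rightarrow> nat" where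
  "B n k = card {p \<in> dyck_paths n. \<exists>(x, y) \<in> visited p. y - x \<ge> int k}"

text \<open>The division is exact, see \<open>catalan_exact\<close> below.\<close>

definition catalan :: "nat \<Rightarrow> nat" where
  "catalan n = ((2 * n) choose n) div (n + 1)"

lemma catalan_exact: "real (catalan n) = 1 / (real n + 1) * real ((2 * n) choose n)"
proof -
  have "Suc n * ((2 * n) choose Suc n) = n * ((2 * n) choose n)"
    using binomial_absorb_comp[of "2 * n" n] binomial_absorption[of n "2 * n"]
    by (cases n) (simp_all add: mult.commute)
  then have "(n + 1) dvd n * ((2 * n) choose n)"
    by (metis Suc_eq_plus1 dvd_triv_left)
  moreover have "coprime (n + 1) n" by simp
  ultimately have "(n + 1) dvd ((2 * n) choose n)"
    using coprime_dvd_mult_right_iff by blast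
  then show ?thesis
    unfolding catalan_def by (simp add: real_of_nat_div)
qed

lemma finite_dyck_paths: "finite (dyck_paths n)"
proof (rule finite_subset)
  have "set p \<subseteq> {Up, Rgt}" for p
    using step.exhaust by blast
  then show "dyck_paths n \<subseteq> {p. set p \<subseteq> {Up, Rgt} \<and> length p = 2 * n}"
    by (auto simp: dyck_paths_def)
  show "finite {p. set p \<subseteq> {Up, Rgt} \<and> length p = 2 * n}"
    by (rule finite_lists_length_eq) simp
qed

end

theory Submission
  imports Defs
begin

text \<open>
  A nonempty Dyck path has a first return to the diagonal, and this splits it uniquely as
  \<open>Up # a @ Rgt # b\<close> with Dyck paths \<open>a\<close> of order \<open>i - 1\<close> and \<open>b\<close> of order \<open>n - i\<close>, where the
  return happens at \<open>(i, i)\<close>. The part \<open>a\<close> runs one unit higher than a path that starts on the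
  diagonal, so for \<open>k \<ge> 1\<close> the whole path reaches the line \<open>y = x + k\<close> if and only if \<open>a\<close> reaches
  \<open>y = x + (k - 1)\<close> or \<open>b\<close> reaches \<open>y = x + k\<close>. Inclusion and exclusion on the pairs \<open>(a, b)\<close> gives
  one summand of the recurrence for each \<open>i\<close>.

  The summands contain Catalan numbers in place of the numbers of Dyck paths. That these
  agree is proved through the ballot numbers: paths that start at an arbitrary height \<open>h\<close>
  satisfy a two-term recurrence on the first step, whose solution is a difference of two
  binomial coefficients.

  All of this is done with a recursive description of paths by their height \<open>y - x\<close> over the
  diagonal (\<open>descends\<close>, \<open>reaches\<close>); \<open>descends_iff_visited\<close> and \<open>reaches_iff_visited\<close> translate
  between it and visited lattice points. The recurrence determines the numbers because its
  right-hand side only involves orders below \<open>n\<close>.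
\<close>

section \<open>Paths described by their height over the diagonal\<close>

text \<open>
  The starting height \<open>h\<close> is a parameter, since both the recursion on the first step and the
  first-return decomposition leave the diagonal: \<open>descends 0\<close> characterises Dyck paths.
\<close>

fun descends :: "nat \<Rightarrow> step list \<Rightarrow> bool" where
  "descends h [] \<longleftrightarrow> h = 0"
| "descends h (Up # p) \<longleftrightarrow> descends (Suc h) p"
| "descends 0 (Rgt # p) \<longleftrightarrow> False"
| "descends (Suc h) (Rgt # p) \<longleftrightarrow> descends h p"

text \<open>
  The truncated \<open>h - 1\<close> differs from the true height only after a step below the diagonal,
  which \<open>descends\<close> excludes.
\<close>

fun reaches :: "nat \<Rightarrow> nat \<Rightarrow> step list \<Rightarrow> bool" where
  "reaches k h [] \<longleftrightarrow> k \<le> h"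
| "reaches k h (Up # p) \<longleftrightarrow> k \<le> h \<or> reaches k (Suc h) p"
| "reaches k h (Rgt # p) \<longleftrightarrow> k \<le> h \<or> reaches k (h - 1) p"

lemma point_after_0 [simp]: "point_after p 0 = 0"
  by (simp add: point_after_def)

lemma point_after_Cons_Suc [simp]:
  "point_after (s # p) (Suc j) = step_vec s + point_after p j"
  by (simp add: point_after_def)

lemma visited_Nil [simp]: "visited [] = {(0, 0)}"
  by (simp add: visited_def zero_prod_def)

lemma visited_Cons:
  "visited (s # p) = insert 0 ((\<lambda>v. step_vec s + v) ` visited p)"
  by (simp add: visited_def atLeast0_atMost_Suc_eq_insert_0 image_image del: image_Suc_atLeastAtMost)

lemma origin_visited: "(0, 0) \<in> visited p"
proof -
  have "point_after p 0 \<in> visited p" unfolding visited_def by (rule imageI) simp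
  then show ?thesis by (simp add: zero_prod_def)
qed

lemma ball_visited_Cons:
  "(\<forall>(x, y) \<in> visited (s # p). P x y) \<longleftrightarrow>
     P 0 0 \<and> (\<forall>(x, y) \<in> visited p. P (fst (step_vec s) + x) (snd (step_vec s) + y))"
  by (simp add: visited_Cons case_prod_beta)

lemma bex_visited_Cons:
  "(\<exists>(x, y) \<in> visited (s # p). P x y) \<longleftrightarrow>
     P 0 0 \<or> (\<exists>(x, y) \<in> visited p. P (fst (step_vec s) + x) (snd (step_vec s) + y))"
  by (simp add: visited_Cons case_prod_beta)

lemma descends_iff_visited:
  "descends h p \<longleftrightarrow>
     (\<forall>(x, y) \<in> visited p. 0 \<le> int h + (y - x)) \<and>
     int h + (snd (point_after p (length p)) - fst (point_after p (length p))) = 0"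
proof (induction h p rule: descends.induct)
  case (3 p)
  have "\<not> (\<forall>(x, y) \<in> visited (Rgt # p). 0 \<le> int 0 + (y - x))"
    unfolding ball_visited_Cons using origin_visited[of p] by force
  then show ?case by (simp only: descends.simps simp_thms)
qed (simp_all only: ball_visited_Cons descends.simps, simp_all add: algebra_simps)

lemma reaches_iff_visited:
  assumes "descends h p"
  shows "reaches k h p \<longleftrightarrow> (\<exists>(x, y) \<in> visited p. int h + (y - x) \<ge> int k)"
  using assms
  by (induction h p rule: descends.induct)
    (simp_all only: bex_visited_Cons reaches.simps descends.simps, auto simp: algebra_simps)

lemma point_after_length: "fst (point_after p (length p)) + snd (point_after p (length p)) = int (length p)"
proof (induction p)
  case (Cons s p)
  then show ?case by (cases s) simp_all
qed simp

lemma dyck_paths_eq_descends: "dyck_paths n = {p. descends 0 p \<and> length p = 2 * n}"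
proof -
  have "point_after p (length p) = (int n, int n) \<longleftrightarrow>
        snd (point_after p (length p)) - fst (point_after p (length p)) = 0"
    if "length p = 2 * n" for p
    using point_after_length[of p] that by (auto simp: prod_eq_iff)
  then show ?thesis
    unfolding dyck_paths_def descends_iff_visited by auto
qed

lemma B_eq_card_reaches: "B n k = card {p \<in> dyck_paths n. reaches k 0 p}"
proof -
  have "reaches k 0 p \<longleftrightarrow> (\<exists>(x, y) \<in> visited p. y - x \<ge> int k)" if "p \<in> dyck_paths n" for p
    using that reaches_iff_visited[of 0 p k] by (simp add: dyck_paths_eq_descends)
  then show ?thesis
    unfolding B_def by (intro arg_cong[where f = card] Collect_cong conj_cong) simp_all
qed

section \<open>Ballot numbers and Catalan numbers\<close>

lemma descends_height_le_length: "descends h p \<Longrightarrow> h \<le> length p"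
  by (induction h p rule: descends.induct) auto

lemma descends_even: "descends h p \<Longrightarrow> even (h + length p)"
  by (induction h p rule: descends.induct) auto

lemma finite_lists_of_steps: "finite {p :: step list. length p = N}"
proof -
  have "UNIV = {Up, Rgt}" using step.exhaust by blast
  then have "finite (UNIV :: step set)" by (metis finite.simps)
  from finite_lists_length_eq[OF this, of N] show ?thesis by simp
qed

lemma card_descends_Suc:
  "card {p. descends h p \<and> length p = Suc N} =
     card {p. descends (Suc h) p \<and> length p = N} +
     (if h = 0 then 0 else card {p. descends (h - 1) p \<and> length p = N})"
proof -
  let ?D = "\<lambda>h. {p. descends h p \<and> length p = N}"
  have fin: "finite (?D h)" for h
    by (rule finite_subset[OF _ finite_lists_of_steps[of N]]) auto
  have *: "descends h (Rgt # p) \<longleftrightarrow> h \<noteq> 0 \<and> descends (h - 1) p" for p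
    by (cases h) auto
  have "p \<in> {p. descends h p \<and> length p = Suc N} \<longleftrightarrow>
        p \<in> (#) Up ` ?D (Suc h) \<union> (#) Rgt ` (if h = 0 then {} else ?D (h - 1))" for p
  proof (cases p)
    case (Cons s q)
    then show ?thesis by (cases s) (auto simp: * image_iff)
  qed auto
  then have "{p. descends h p \<and> length p = Suc N} =
        (#) Up ` ?D (Suc h) \<union> (#) Rgt ` (if h = 0 then {} else ?D (h - 1))"
    by blast
  also have "card \<dots> = card ((#) Up ` ?D (Suc h)) + card ((#) Rgt ` (if h = 0 then {} else ?D (h - 1)))"
    by (rule card_Un_disjoint) (use fin in auto)
  finally show ?thesis by (simp add: card_image)
qed

text \<open>
  For \<open>u \<ge> 1\<close> both sides satisfy the recurrence of \<open>card_descends_Suc\<close>: on the right this is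
  Pascal's rule applied to each of the two binomial coefficients. At \<open>h = 0\<close> the recurrence lacks
  its second summand; the value that the formula assigns to it is
  \<open>(2 u - 1 choose u) - (2 u - 1 choose (u - 1))\<close>, which vanishes by symmetry. For \<open>u = 0\<close> only
  the path without up steps descends, since a path shorter than its starting height cannot.
\<close>

lemma card_descends_ballot:
  assumes "N = 2 * u + h"
  shows "int (card {p. descends h p \<and> length p = N}) =
           int (N choose u) - (if u = 0 then 0 else int (N choose (u - 1)))"
  using assms
proof (induction N arbitrary: u h)
  case 0
  then have "{p. descends h p \<and> length p = 0} = {[]}" by auto
  with 0 show ?case by simp
next
  case (Suc N)
  show ?case
  proof (cases u)
    case 0
    with Suc.prems have h: "h = Suc N" by simp
    have "{p. descends (Suc h) p \<and> length p = N} = {}"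
      using h by (auto dest: descends_height_le_length)
    then have none: "card {p. descends (Suc h) p \<and> length p = N} = 0"
      by (simp only: card.empty)
    have "int (card {p. descends (h - 1) p \<and> length p = N}) = 1"
      using Suc.IH[of 0 "h - 1"] h by simp
    with none 0 h show ?thesis unfolding card_descends_Suc by simp
  next
    case (Suc v)
    have up: "int (card {p. descends (Suc h) p \<and> length p = N}) =
              int (N choose v) - (if v = 0 then 0 else int (N choose (v - 1)))"
      using Suc.IH[of v "Suc h"] Suc.prems Suc by simp
    have right: "(if h = 0 then 0 else int (card {p. descends (h - 1) p \<and> length p = N})) =
              int (N choose Suc v) - int (N choose v)"
    proof (cases "h = 0")
      case True
      then have "N = Suc (2 * v)" using Suc.prems Suc by simp
      with True show ?thesis using binomial_symmetric[of v N] by simp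
    next
      case False
      then show ?thesis using Suc.IH[of "Suc v" "h - 1"] Suc.prems Suc by simp
    qed
    have "int (card {p. descends h p \<and> length p = Suc N}) =
            (int (N choose v) - (if v = 0 then 0 else int (N choose (v - 1)))) +
            (int (N choose Suc v) - int (N choose v))"
      unfolding card_descends_Suc up[symmetric] right[symmetric] by simp
    also have "\<dots> = int (Suc N choose Suc v) - int (Suc N choose v)"
      by (cases v) simp_all
    finally show ?thesis using Suc by simp
  qed
qed

text \<open>
  The subtracted coefficient is \<open>n / (n + 1)\<close> times the central one, which leaves
  \<open>1 / (n + 1)\<close> of the latter.
\<close>

lemma card_dyck_paths: "card (dyck_paths n) = catalan n"
proof -
  let ?c = "int (card (dyck_paths n))" and ?b = "int ((2 * n) choose n)"
  define d where "d = (if n = 0 then 0 else int ((2 * n) choose (n - 1)))"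
  have "?c = ?b - d"
    unfolding d_def using card_descends_ballot[of "2 * n" n 0] by (simp add: dyck_paths_eq_descends)
  moreover have "(int n + 1) * d = int n * ?b"
  proof (cases n)
    case (Suc m)
    have "Suc m * ((2 * n) choose Suc m) = (2 * n - m) * ((2 * n) choose m)"
      using binomial_absorb_comp[of "2 * n" m] binomial_absorption[of m "2 * n"] by simp
    moreover have "2 * n - m = n + 1" using Suc by simp
    ultimately have "int (Suc m) * int ((2 * n) choose Suc m) = int (n + 1) * int ((2 * n) choose m)"
      by (metis of_nat_mult)
    then show ?thesis using Suc by (simp add: d_def)
  qed (simp add: d_def)
  ultimately have "(int n + 1) * ?c = (int n + 1) * ?b - int n * ?b"
    by (simp only: right_diff_distrib)
  also have "\<dots> = ?b" by (simp add: distrib_right)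
  finally have "int ((n + 1) * card (dyck_paths n)) = ?b"
    by (simp only: of_nat_mult of_nat_add of_nat_1)
  then have "(n + 1) * card (dyck_paths n) = (2 * n) choose n" by linarith
  then show ?thesis unfolding catalan_def by (metis Suc_eq_plus1 nonzero_mult_div_cancel_left nat.distinct(1))
qed

lemma B_0: "B n 0 = catalan n"
proof -
  have "reaches 0 h p" for h p by (cases "(0::nat, h, p)" rule: reaches.cases) auto
  then show ?thesis by (simp add: B_eq_card_reaches card_dyck_paths)
qed

lemma dyck_paths_0: "dyck_paths 0 = {[]}"
  by (auto simp: dyck_paths_eq_descends)

lemma B_0_left: "k \<ge> 1 \<Longrightarrow> B 0 k = 0"
  by (auto simp: B_eq_card_reaches dyck_paths_0 intro!: card_eq_0_iff[THEN iffD2])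

section \<open>The first-return decomposition\<close>

text \<open>
  The split is at the first step that arrives at height \<open>0\<close>. The part before it stays at height
  at least \<open>1\<close>, so lowered by one unit it starts at \<open>h\<close>. The height \<open>h\<close> is arbitrary
  because the path read so far changes it; the decomposition itself is the case \<open>h = 0\<close>.
\<close>

lemma descends_split_at_first_return:
  "descends (Suc h) p \<Longrightarrow> \<exists>a b. p = a @ Rgt # b \<and> descends h a \<and> descends 0 b"
proof (induction p arbitrary: h)
  case (Cons s p)
  show ?case
  proof (cases s)
    case Up
    with Cons.prems have "descends (Suc (Suc h)) p" by simp
    from Cons.IH[OF this] obtain a b where "p = a @ Rgt # b" "descends (Suc h) a" "descends 0 b"
      by blast
    with Up show ?thesis by (intro exI[of _ "Up # a"] exI[of _ b]) simp
  next
    case Rgt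
    show ?thesis
    proof (cases h)
      case 0
      with Rgt Cons.prems show ?thesis by (intro exI[of _ "[]"] exI[of _ p]) simp
    next
      case (Suc h')
      with Rgt Cons.prems have "descends (Suc h') p" by simp
      from Cons.IH[OF this] obtain a b where "p = a @ Rgt # b" "descends h' a" "descends 0 b"
        by blast
      with Rgt Suc show ?thesis by (intro exI[of _ "Rgt # a"] exI[of _ b]) simp
    qed
  qed
qed simp

lemma descends_append_Rgt:
  "descends h a \<Longrightarrow> descends 0 b \<Longrightarrow> descends (Suc h) (a @ Rgt # b)"
  by (induction h a rule: descends.induct) auto

lemma first_return_unique:
  assumes "descends h a" "descends h a'" "a @ Rgt # b = a' @ Rgt # b'"
  shows "a = a' \<and> b = b'"
  using assms
proof (induction h a arbitrary: a' rule: descends.induct)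
  case (1 h)
  then show ?case by (cases a') auto
next
  case (2 h p)
  from "2.prems" obtain q where q: "a' = Up # q" by (cases a') simp_all
  with "2.prems" have "p = q \<and> b = b'" by (intro "2.IH") simp_all
  with q show ?case by simp
next
  case (4 h p)
  from "4.prems" obtain q where q: "a' = Rgt # q" by (cases a') simp_all
  with "4.prems" have "p = q \<and> b = b'" by (intro "4.IH") simp_all
  with q show ?case by simp
qed simp

text \<open>
  The steps of \<open>a\<close> are taken one unit higher than \<open>h\<close> indicates, hence the lower target
  \<open>k - 1\<close> for \<open>a\<close>; the step \<open>Rgt\<close> then leads to the diagonal, where \<open>b\<close> starts.
\<close>

lemma reaches_append_Rgt:
  assumes "descends h a" "k \<ge> 1"
  shows "reaches k (Suc h) (a @ Rgt # b) \<longleftrightarrow> reaches (k - 1) h a \<or> reaches k 0 b"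
  using assms by (induction h a rule: descends.induct) auto

definition join_return :: "step list \<times> step list \<Rightarrow> step list" where
  "join_return = (\<lambda>(a, b). Up # a @ Rgt # b)"

lemma inj_on_join_return: "inj_on join_return ({a. descends 0 a} \<times> UNIV)"
proof (rule inj_onI)
  fix u v
  assume "u \<in> {a. descends 0 a} \<times> UNIV" "v \<in> {a. descends 0 a} \<times> UNIV"
    and "join_return u = join_return v"
  then show "u = v"
    using first_return_unique[of 0 "fst u" "fst v" "snd u" "snd v"]
    by (simp add: join_return_def case_prod_beta mem_Times_iff prod_eq_iff)
qed

lemma length_dyck_path: "p \<in> dyck_paths n \<Longrightarrow> length p = 2 * n"
  by (simp add: dyck_paths_eq_descends)

lemma dyck_paths_eq_UN_join_return:
  assumes "n \<ge> 1"
  shows "dyck_paths n = (\<Union>i\<in>{1..n}. join_return ` (dyck_paths (i - 1) \<times> dyck_paths (n - i)))"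
proof (intro set_eqI iffI)
  fix p assume p: "p \<in> dyck_paths n"
  then obtain s q where sq: "p = s # q" using assms by (cases p) (auto simp: dyck_paths_eq_descends)
  with p have "s = Up" "descends 1 q" by (cases s; simp add: dyck_paths_eq_descends)+
  then obtain a b where ab: "q = a @ Rgt # b" "descends 0 a" "descends 0 b"
    using descends_split_at_first_return[of 0 q] by auto
  obtain i j where ij: "length a = 2 * i" "length b = 2 * j"
    using ab(2,3)[THEN descends_even] by (auto elim!: evenE)
  have "n = Suc (i + j)"
    using p sq ab ij by (simp add: dyck_paths_eq_descends)
  moreover have "p = join_return (a, b)"
    using sq \<open>s = Up\<close> ab by (simp add: join_return_def)
  ultimately show "p \<in> (\<Union>i\<in>{1..n}. join_return ` (dyck_paths (i - 1) \<times> dyck_paths (n - i)))"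
    using ab ij by (intro UN_I[of "Suc i"] image_eqI[of _ _ "(a, b)"]) (auto simp: dyck_paths_eq_descends)
next
  fix p assume "p \<in> (\<Union>i\<in>{1..n}. join_return ` (dyck_paths (i - 1) \<times> dyck_paths (n - i)))"
  then obtain i a b where i: "i \<in> {1..n}" and p: "p = join_return (a, b)"
    and a: "a \<in> dyck_paths (i - 1)" and b: "b \<in> dyck_paths (n - i)"
    by blast
  have "Suc (i - 1 + (n - i)) = n" using i by simp
  then have "length p = 2 * n"
    using p a[THEN length_dyck_path] b[THEN length_dyck_path] by (simp add: join_return_def)
  moreover have "descends 0 p"
    using p a b by (simp add: join_return_def dyck_paths_eq_descends descends_append_Rgt)
  ultimately show "p \<in> dyck_paths n" by (simp add: dyck_paths_eq_descends)
qed

text \<open>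
  The first return happens after \<open>2 i\<close> steps, so the index \<open>i\<close> can be recovered from the path.
\<close>

lemma disjoint_join_return:
  assumes "i \<in> {1..n}" "j \<in> {1..n}" "i \<noteq> j"
  shows "join_return ` (dyck_paths (i - 1) \<times> dyck_paths (n - i)) \<inter>
         join_return ` (dyck_paths (j - 1) \<times> dyck_paths (n - j)) = {}"
proof -
  have False if "join_return (a, b) = join_return (a', b')"
      "a \<in> dyck_paths (i - 1)" "a' \<in> dyck_paths (j - 1)" for a b a' b'
  proof -
    have "a = a'"
      using that first_return_unique[of 0 a a' b b'] by (simp add: join_return_def dyck_paths_eq_descends)
    with that have "i - 1 = j - 1" by (auto dest!: length_dyck_path)
    with assms show False by auto
  qed
  then show ?thesis by fastforce
qed

section \<open>The recurrence\<close>

text \<open>Inclusion and exclusion for the two ways in which a pair can qualify.\<close>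

lemma card_pairs_disj:
  assumes "finite X" "finite Y"
  shows "int (card {(a, b) \<in> X \<times> Y. P a \<or> Q b}) =
           int (card {a \<in> X. P a}) * int (card Y) + int (card X) * int (card {b \<in> Y. Q b})
           - int (card {a \<in> X. P a}) * int (card {b \<in> Y. Q b})"
proof -
  let ?L = "{a \<in> X. P a} \<times> Y" and ?R = "X \<times> {b \<in> Y. Q b}"
  have "card ?L + card ?R = card (?L \<union> ?R) + card (?L \<inter> ?R)"
    by (rule card_Un_Int) (use assms in auto)
  moreover have "?L \<union> ?R = {(a, b) \<in> X \<times> Y. P a \<or> Q b}" by auto
  moreover have "?L \<inter> ?R = {a \<in> X. P a} \<times> {b \<in> Y. Q b}" by auto
  ultimately have "card {a \<in> X. P a} * card Y + card X * card {b \<in> Y. Q b} =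
      card {(a, b) \<in> X \<times> Y. P a \<or> Q b} + card {a \<in> X. P a} * card {b \<in> Y. Q b}"
    by (simp add: card_cartesian_product)
  then have "int (card {a \<in> X. P a} * card Y + card X * card {b \<in> Y. Q b}) =
      int (card {(a, b) \<in> X \<times> Y. P a \<or> Q b} + card {a \<in> X. P a} * card {b \<in> Y. Q b})"
    by (rule arg_cong)
  then show ?thesis by simp
qed

lemma B_recurrence:
  assumes "n \<ge> 1" "k \<ge> 1"
  shows "int (B n k) =
           (\<Sum>i = 1..n. int (B (i - 1) (k - 1)) * int (catalan (n - i))
                     + int (catalan (i - 1)) * int (B (n - i) k)
                     - int (B (i - 1) (k - 1)) * int (B (n - i) k))"
proof -
  define Pairs where "Pairs i = {(a, b) \<in> dyck_paths (i - 1) \<times> dyck_paths (n - i).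
      reaches (k - 1) 0 a \<or> reaches k 0 b}" for i
  have Pairs_subset: "Pairs i \<subseteq> dyck_paths (i - 1) \<times> dyck_paths (n - i)" for i
    by (auto simp: Pairs_def)
  have finite_Pairs: "finite (Pairs i)" for i
    by (rule finite_subset[OF Pairs_subset]) (simp add: finite_dyck_paths)
  have reaches_join: "reaches k 0 (join_return (a, b)) \<longleftrightarrow> reaches (k - 1) 0 a \<or> reaches k 0 b"
    if "a \<in> dyck_paths m" for a b m
    using that assms(2) reaches_append_Rgt[of 0 a k b]
    by (simp add: join_return_def dyck_paths_eq_descends)
  have "{p \<in> dyck_paths n. reaches k 0 p} = (\<Union>i\<in>{1..n}. join_return ` Pairs i)"
    unfolding dyck_paths_eq_UN_join_return[OF assms(1)] Pairs_def
    using reaches_join by fastforce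
  then have "B n k = card (\<Union>i\<in>{1..n}. join_return ` Pairs i)"
    by (simp add: B_eq_card_reaches)
  also have "\<dots> = (\<Sum>i = 1..n. card (join_return ` Pairs i))"
  proof (rule card_UN_disjoint)
    show "\<forall>i\<in>{1..n}. \<forall>j\<in>{1..n}. i \<noteq> j \<longrightarrow> join_return ` Pairs i \<inter> join_return ` Pairs j = {}"
      using disjoint_join_return Pairs_subset by (meson disjoint_iff image_mono subsetD)
  qed (use finite_Pairs in auto)
  also have "\<dots> = (\<Sum>i = 1..n. card (Pairs i))"
  proof (intro sum.cong refl card_image inj_on_subset[OF inj_on_join_return])
    show "Pairs i \<subseteq> {a. descends 0 a} \<times> UNIV" for i
      by (auto simp: Pairs_def dyck_paths_eq_descends)
  qed
  finally have "int (B n k) = (\<Sum>i = 1..n. int (card (Pairs i)))" by simp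
  also have "\<dots> = (\<Sum>i = 1..n. int (B (i - 1) (k - 1)) * int (catalan (n - i))
                     + int (catalan (i - 1)) * int (B (n - i) k)
                     - int (B (i - 1) (k - 1)) * int (B (n - i) k))"
    unfolding Pairs_def card_pairs_disj[OF finite_dyck_paths finite_dyck_paths]
    by (simp add: B_eq_card_reaches card_dyck_paths)
  finally show ?thesis .
qed

theorem theorem2p1:
  shows "(\<forall>n k. n \<ge> 1 \<longrightarrow> k \<ge> 1 \<longrightarrow>
            int (B n k) =
              (\<Sum>i = 1..n. int (B (i - 1) (k - 1)) * int (catalan (n - i))
                        + int (catalan (i - 1)) * int (B (n - i) k)
                        - int (B (i - 1) (k - 1)) * int (B (n - i) k)))
       \<and> (\<forall>f :: nat \<Rightarrow> nat \<Rightarrow> int.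
            (\<forall>n. f n 0 = int (catalan n)) \<longrightarrow>
            (\<forall>k. k \<ge> 1 \<longrightarrow> f 0 k = 0) \<longrightarrow>
            (\<forall>n k. n \<ge> 1 \<longrightarrow> k \<ge> 1 \<longrightarrow>
               f n k =
                 (\<Sum>i = 1..n. f (i - 1) (k - 1) * int (catalan (n - i))
                           + int (catalan (i - 1)) * f (n - i) k
                           - f (i - 1) (k - 1) * f (n - i) k)) \<longrightarrow>
            (\<forall>n k. f n k = int (B n k)))"
proof (intro conjI allI impI)
  fix n k :: nat
  assume "n \<ge> 1" "k \<ge> 1"
  then show "int (B n k) =
              (\<Sum>i = 1..n. int (B (i - 1) (k - 1)) * int (catalan (n - i))
                        + int (catalan (i - 1)) * int (B (n - i) k)
                        - int (B (i - 1) (k - 1)) * int (B (n - i) k))"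
    by (rule B_recurrence)
next
  fix f :: "nat \<Rightarrow> nat \<Rightarrow> int" and n k :: nat
  assume f_n0: "\<forall>n. f n 0 = int (catalan n)"
    and f_0k: "\<forall>k. k \<ge> 1 \<longrightarrow> f 0 k = 0"
    and f_rec: "\<forall>n k. n \<ge> 1 \<longrightarrow> k \<ge> 1 \<longrightarrow>
               f n k =
                 (\<Sum>i = 1..n. f (i - 1) (k - 1) * int (catalan (n - i))
                           + int (catalan (i - 1)) * f (n - i) k
                           - f (i - 1) (k - 1) * f (n - i) k)"
  show "f n k = int (B n k)"
  proof (induction n arbitrary: k rule: less_induct)
    case (less n)
    consider "k = 0" | "n = 0" "k \<ge> 1" | "n \<ge> 1" "k \<ge> 1" by linarith
    then show ?case
    proof cases
      case 1
      then show ?thesis using f_n0 by (simp add: B_0)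
    next
      case 2
      then show ?thesis using f_0k by (simp add: B_0_left)
    next
      case 3
      have "f n k = (\<Sum>i = 1..n. f (i - 1) (k - 1) * int (catalan (n - i))
                           + int (catalan (i - 1)) * f (n - i) k
                           - f (i - 1) (k - 1) * f (n - i) k)"
        using f_rec 3 by blast
      also have "\<dots> = int (B n k)"
        unfolding B_recurrence[OF 3]
      proof (intro sum.cong refl)
        fix i assume "i \<in> {1..n}"
        then have "i - 1 < n" "n - i < n" by auto
        from this[THEN less.IH] show "f (i - 1) (k - 1) * int (catalan (n - i))
                     + int (catalan (i - 1)) * f (n - i) k
                     - f (i - 1) (k - 1) * f (n - i) k =
                   int (B (i - 1) (k - 1)) * int (catalan (n - i))
                     + int (catalan (i - 1)) * int (B (n - i) k)
                     - int (B (i - 1) (k - 1)) * int (B (n - i) k)"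
          by simp
      qed
      finally show ?thesis .
    qed
  qed
qed

end
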